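(* Let $H$ be an infinite-dimensional Hilbert space. (i) Let $A\subset H$ be an extremal set with $d(A)=\sqrt{2}$. Then $\chi(A)=1$, and for every $\varepsilon\in(0,\sqrt{2})$ and every positive integer $p$ there exists a $p$-simplex $\Delta$ with its vertices in $A$ such that each edge of $\Delta$ has length not less than $\sqrt{2}-\varepsilon$. (ii) Conversely, let $A$ be a non-empty bounded subset of $H$ with $d(A)=\sqrt{2}$. If for every $\varepsilon\in(0,\sqrt{2})$ and every positive integer $p$ there exists a $p$-simplex $\Delta$ with its vertices in $A$ such that the length of each edge of $\Delta$ is not less than $\sqrt{2}-\varepsilon$, then $A$ is an extremal set.
   Context: Let $(X,\|\cdot\|)$ be a Banach space. For a non-empty bounded subset $A\subset X$, the diameter is $d(A)=\sup\{\|x-y\|: x,y\in A\}$, and for a non-empty $B\subset X$ the relative Chebyshev radius of $A$ with respect to $B$ is $r_B(A)=\inf_{y\in B}\sup_{x\in A}\|x-y\|$. The Jung constant of $X$ is $J(X)=\sup\{r_X(A): A\subset X,\ d(A)=1\}$. For an infinite-dimensional Hilbert space $H$ it is known that $J(H)=1/\sqrt{2}$. A bounded subset $A$ of $X$ consisting of at least two points is called an extremal set if $r_X(A)=J(X)\,d(A)$. The Hausdorff measure of non-compactness $\chi(A)$ is the infimum of the positive numbers $r$ such that $A$ can be covered by finitely many balls of radius $r$ with centers in $X$. A $p$-simplex is the convex hull of $p+1$ points that are affinely independent over $\mathbb{R}$ (its vertices); its edges are the segments joining pairs of distinct vertices. *)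

theory Defs
  imports "HOL-Analysis.Analysis"
begin

text \<open>
  The quantities below are real-valued, so \<^const>\<open>Sup\<close> and \<^const>\<open>Inf\<close> are meaningful only for
  non-empty bounded \<open>A\<close> (and non-empty \<open>B\<close>); as in the source they are only used in that case.
\<close>

definition chebyshev_radius :: "'a::real_normed_vector set \<Rightarrow> 'a set \<Rightarrow> real" where
  "chebyshev_radius B A = (INF y\<in>B. SUP x\<in>A. norm (x - y))"

text \<open>
  Boundedness is explicit because the library's \<^const>\<open>diameter\<close> is unspecified on unbounded sets;
  \<open>diameter A = 1\<close> already excludes the empty set.
\<close>

definition jung_constant :: "'a::real_normed_vector itself \<Rightarrow> real" where
  "jung_constant _ = Sup {chebyshev_radius UNIV A | A :: 'a set. bounded A \<and> diameter A = 1}"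

definition extremal_set :: "'a::real_normed_vector set \<Rightarrow> bool" where
  "extremal_set A \<longleftrightarrow> bounded A \<and> (\<exists>x\<in>A. \<exists>y\<in>A. x \<noteq> y) \<and>
     chebyshev_radius UNIV A = jung_constant TYPE('a) * diameter A"

definition hausdorff_mnc :: "'a::real_normed_vector set \<Rightarrow> real" where
  "hausdorff_mnc A = Inf {r. 0 < r \<and> (\<exists>C. finite C \<and> A \<subseteq> (\<Union>c\<in>C. cball c r))}"

text \<open>
  The library's \<^verbatim>\<open>simplex\<close> requires a Euclidean space and hides the vertex set. Here \<open>V\<close> is the
  vertex set and \<open>D\<close> the simplex itself. \<open>V\<close> is finite because its cardinality is positive.
  Its edges are \<open>closed_segment x y\<close> for distinct \<open>x, y \<in> V\<close>, of length \<open>norm (x - y)\<close>.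
\<close>

definition simplex_with_vertices :: "nat \<Rightarrow> 'a::real_vector set \<Rightarrow> 'a set \<Rightarrow> bool" where
  "simplex_with_vertices p V D \<longleftrightarrow>
     card V = p + 1 \<and> \<not> affine_dependent V \<and> D = convex hull V"

end

theory Submission
  imports Defs
begin

text \<open>
  For a finitely supported probability weight \<open>w\<close> on \<open>A\<close>, the spread is half the mean of
  \<open>|x - y|\<^sup>2\<close>. By Huygens' identity it is the variance about the barycentre, and its supremum
  over all such \<open>w\<close> is the squared Chebyshev radius of \<open>A\<close>. Since the spread is at most
  \<open>d(A)\<^sup>2 / 2\<close>, the Jung constant is at most \<open>1 / sqrt 2\<close>, and equality for \<open>A\<close> forces a weight
  of near-maximal spread to put almost all mass on pairs at distance near \<open>d(A)\<close>. In a finite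
  cover by balls, the restriction to the heaviest ball still has near-maximal spread, which bounds
  the radius from below; and a greedy choice of points avoiding short distances gives the
  simplices. Conversely, uniform weights on nearly regular simplices have spread tending to \<open>1\<close>.
\<close>

section \<open>Algebra of the spread\<close>

definition spread :: "'a::real_normed_vector set \<Rightarrow> ('a \<Rightarrow> real) \<Rightarrow> real" where
  "spread F w = (\<Sum>x\<in>F. \<Sum>y\<in>F. w x * w y * (norm (x - y))\<^sup>2) / 2"

lemma sum_sum_inner:
  fixes F :: "'a::real_inner set"
  shows "(\<Sum>x\<in>F. \<Sum>y\<in>F. w x * w y * inner x y) = (norm (\<Sum>x\<in>F. w x *\<^sub>R x))\<^sup>2"
proof -
  define m where "m = (\<Sum>x\<in>F. w x *\<^sub>R x)"
  have "(norm m)\<^sup>2 = inner (\<Sum>x\<in>F. w x *\<^sub>R x) m"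
    by (simp add: power2_norm_eq_inner m_def)
  also have "\<dots> = (\<Sum>x\<in>F. w x * inner x m)"
    by (simp add: inner_sum_left)
  also have "\<dots> = (\<Sum>x\<in>F. \<Sum>y\<in>F. w x * w y * inner x y)"
    by (simp add: m_def inner_sum_right sum_distrib_left mult.assoc)
  finally show ?thesis
    by (simp add: m_def)
qed

text \<open>Expanding the square leaves two equal terms in the squared norms and the Gram form of
  \<open>sum_sum_inner\<close>. For total mass 1 this is the usual variance formula.\<close>

lemma spread_eq:
  fixes F :: "'a::real_inner set"
  shows "spread F w = sum w F * (\<Sum>x\<in>F. w x * (norm x)\<^sup>2) - (norm (\<Sum>x\<in>F. w x *\<^sub>R x))\<^sup>2"
proof -
  have 1: "w x * w y * (norm (x - y))\<^sup>2 =
      w y * (w x * (norm x)\<^sup>2) + w x * (w y * (norm y)\<^sup>2) - 2 * (w x * w y * inner x y)"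
    for x y :: 'a
    by (simp add: power2_norm_eq_inner inner_diff_left inner_diff_right inner_commute algebra_simps)
  have 2: "(\<Sum>x\<in>F. \<Sum>y\<in>F. w y * (w x * (norm x)\<^sup>2)) = sum w F * (\<Sum>x\<in>F. w x * (norm x)\<^sup>2)"
    by (subst sum.swap) (simp add: sum_product)
  have 3: "(\<Sum>x\<in>F. \<Sum>y\<in>F. w x * (w y * (norm y)\<^sup>2)) = sum w F * (\<Sum>x\<in>F. w x * (norm x)\<^sup>2)"
    by (simp add: sum_product)
  have 4: "(\<Sum>x\<in>F. \<Sum>y\<in>F. 2 * (w x * w y * inner x y)) = 2 * (norm (\<Sum>x\<in>F. w x *\<^sub>R x))\<^sup>2"
    by (simp only: sum_distrib_left[symmetric] sum_sum_inner)
  show ?thesis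
    unfolding spread_def 1 sum.distrib sum_subtractf 2 3 4 by simp
qed

text \<open>Multiplying by the total mass instead of dividing by it also covers signed weights of
  total mass 0; the affine independence argument rests on that case.\<close>

lemma spread_huygens:
  fixes F :: "'a::real_inner set"
  shows "sum w F * (\<Sum>x\<in>F. w x * (norm (x - c))\<^sup>2) =
    spread F w + (norm (sum w F *\<^sub>R c - (\<Sum>x\<in>F. w x *\<^sub>R x)))\<^sup>2"
proof -
  let ?m = "\<Sum>x\<in>F. w x *\<^sub>R x" and ?W = "sum w F"
  have 1: "w x * (norm (x - c))\<^sup>2 = w x * (norm x)\<^sup>2 - 2 * inner (w x *\<^sub>R x) c + w x * (norm c)\<^sup>2" for x
    by (simp add: power2_norm_eq_inner inner_diff_left inner_diff_right inner_commute algebra_simps)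
  have "(\<Sum>x\<in>F. w x * (norm (x - c))\<^sup>2) =
      (\<Sum>x\<in>F. w x * (norm x)\<^sup>2) - 2 * inner ?m c + ?W * (norm c)\<^sup>2"
    unfolding 1 sum.distrib sum_subtractf sum_distrib_left[symmetric] sum_distrib_right[symmetric]
      inner_sum_left[symmetric] ..
  moreover have "(norm (?W *\<^sub>R c - ?m))\<^sup>2 = ?W * (?W * (norm c)\<^sup>2) - 2 * ?W * inner ?m c + (norm ?m)\<^sup>2"
    unfolding power2_norm_eq_inner inner_diff_left inner_diff_right
    by (simp add: inner_commute)
  ultimately show ?thesis
    unfolding spread_eq by (simp only: ring_distribs)
qed

lemma spread_nonneg:
  assumes "\<And>x. x \<in> F \<Longrightarrow> w x \<ge> 0"
  shows "spread F w \<ge> 0"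
  unfolding spread_def by (intro divide_nonneg_nonneg sum_nonneg mult_nonneg_nonneg assms) auto

text \<open>In Huygens' identity about \<open>c\<close> the displacement of the barycentre only adds
  a square, so the spread is at most the mass times the second moment about
  \<open>c\<close>.\<close>

lemma spread_le_ball:
  fixes F :: "'a::real_inner set"
  assumes "\<And>x. x \<in> F \<Longrightarrow> w x \<ge> 0" and "\<And>x. x \<in> F \<Longrightarrow> norm (x - c) \<le> R"
  shows "spread F w \<le> (sum w F * R)\<^sup>2"
proof -
  have "(\<Sum>x\<in>F. w x * (norm (x - c))\<^sup>2) \<le> (\<Sum>x\<in>F. w x * R\<^sup>2)"
    using assms by (intro sum_mono mult_left_mono power_mono) auto
  then have "sum w F * (\<Sum>x\<in>F. w x * (norm (x - c))\<^sup>2) \<le> sum w F * (sum w F * R\<^sup>2)"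
    using assms(1) by (intro mult_left_mono) (auto simp: sum_distrib_right sum_nonneg)
  then show ?thesis
    unfolding spread_huygens by (simp add: power2_eq_square algebra_simps) (smt (verit) zero_le_square)
qed

text \<open>If \<open>w\<close> is non-negative and \<open>2 * d\<close> bounds all squared
  distances, every term on the right is non-negative. The deficit then grows with \<open>F\<close>
  and controls the weight of pairs lying close together.\<close>

lemma spread_deficit:
  "(sum w F)\<^sup>2 * d - spread F w = (\<Sum>x\<in>F. \<Sum>y\<in>F. w x * w y * (2 * d - (norm (x - y))\<^sup>2)) / 2"
proof -
  have "(\<Sum>x\<in>F. \<Sum>y\<in>F. w x * w y * (2 * d)) = (sum w F)\<^sup>2 * (2 * d)"
    by (simp add: power2_eq_square sum_product sum_distrib_right[symmetric])
  then show ?thesis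
    by (simp add: spread_def right_diff_distrib sum_subtractf diff_divide_distrib)
qed

section \<open>Elementary bounds for the Chebyshev radius\<close>

lemma norm_le_Sup_norm:
  fixes A :: "'a::real_normed_vector set"
  assumes "bounded A" and "x \<in> A"
  shows "norm (x - y) \<le> (SUP x\<in>A. norm (x - y))"
proof (rule cSUP_upper[OF assms(2)])
  obtain a where "\<forall>x\<in>A. norm x \<le> a"
    using assms(1) bounded_iff by blast
  then have "norm (x - y) \<le> a + norm y" if "x \<in> A" for x
    using that norm_triangle_ineq4[of x y] by (smt (verit))
  then show "bdd_above ((\<lambda>x. norm (x - y)) ` A)"
    by (auto simp: bdd_above_def)
qed

lemma Sup_norm_nonneg:
  fixes A :: "'a::real_normed_vector set"
  assumes "bounded A" and "A \<noteq> {}"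
  shows "0 \<le> (SUP x\<in>A. norm (x - y))"
  using assms norm_le_Sup_norm[OF assms(1)] by (meson all_not_in_conv norm_ge_zero order_trans)

lemma chebyshev_radius_nonneg:
  assumes "bounded A" and "A \<noteq> {}"
  shows "0 \<le> chebyshev_radius UNIV A"
  unfolding chebyshev_radius_def using Sup_norm_nonneg[OF assms] by (intro cINF_greatest) auto

lemma chebyshev_radius_le:
  assumes "bounded A" and "A \<noteq> {}" and "\<And>x. x \<in> A \<Longrightarrow> norm (x - y) \<le> R"
  shows "chebyshev_radius UNIV A \<le> R"
proof -
  have "chebyshev_radius UNIV A \<le> (SUP x\<in>A. norm (x - y))"
    unfolding chebyshev_radius_def using Sup_norm_nonneg[OF assms(1,2)]
    by (intro cINF_lower) (auto simp: bdd_below_def)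
  also have "\<dots> \<le> R"
    using assms by (intro cSUP_least) auto
  finally show ?thesis .
qed

text \<open>The easy half of the duality: each centre \<open>y\<close> gives a ball containing
  \<open>A\<close>, to which \<open>spread_le_ball\<close> applies.\<close>

lemma spread_le_chebyshev_radius:
  fixes A :: "'a::real_inner set"
  assumes "bounded A" and "F \<subseteq> A" and "\<And>x. x \<in> F \<Longrightarrow> w x \<ge> 0" and pos: "0 < sum w F"
  shows "spread F w \<le> (sum w F * chebyshev_radius UNIV A)\<^sup>2"
proof -
  have ne: "A \<noteq> {}"
    using pos assms(2) by auto
  \<comment> \<open>Dividing by the mass gives a lower bound free of \<open>y\<close>, which passes
    to the infimum over all centres.\<close>
  have "sqrt (spread F w) / sum w F \<le> (SUP x\<in>A. norm (x - y))" for y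
  proof -
    have "spread F w \<le> (sum w F * (SUP x\<in>A. norm (x - y)))\<^sup>2"
      using assms norm_le_Sup_norm[OF assms(1)] by (intro spread_le_ball[where c = y]) auto
    then have "sqrt (spread F w) \<le> sum w F * (SUP x\<in>A. norm (x - y))"
      using pos Sup_norm_nonneg[OF assms(1) ne] by (intro real_le_lsqrt) auto
    then show ?thesis
      using pos by (simp add: field_simps)
  qed
  then have "sqrt (spread F w) / sum w F \<le> chebyshev_radius UNIV A"
    unfolding chebyshev_radius_def by (intro cINF_greatest) auto
  then have "sqrt (spread F w) \<le> sum w F * chebyshev_radius UNIV A"
    using pos by (simp add: field_simps)
  then show ?thesis
    using sqrt_le_D by blast
qed

section \<open>Duality between spread and Chebyshev radius\<close>

text \<open>Vanishing off \<open>F\<close> lets the support be enlarged without changing weighted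
  sums.\<close>

definition prob_weight :: "'a set \<Rightarrow> 'a set \<Rightarrow> ('a \<Rightarrow> real) \<Rightarrow> bool" where
  "prob_weight A F w \<longleftrightarrow>
     finite F \<and> F \<subseteq> A \<and> (\<forall>x. 0 \<le> w x) \<and> (\<forall>x. x \<notin> F \<longrightarrow> w x = 0) \<and> sum w F = 1"

text \<open>The new weight mixes \<open>w\<close> with a unit mass at \<open>x\<close>. Huygens'
  identity is applied about the old barycentre \<open>m\<close>: the second moment is the mixture of
  \<open>spread F w\<close> and \<open>(norm (x - m))\<^sup>2\<close>, and the barycentre moves by
  \<open>t * norm (x - m)\<close>.\<close>

lemma prob_weight_move:
  fixes A :: "'a::real_inner set"
  assumes p: "prob_weight A F w" and "x \<in> A" and t: "0 \<le> t" "t \<le> 1"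
  obtains G u where "prob_weight A G u"
    and "spread G u = (1 - t) * spread F w + t * (1 - t) * (norm (x - (\<Sum>y\<in>F. w y *\<^sub>R y)))\<^sup>2"
proof -
  define m where "m = (\<Sum>y\<in>F. w y *\<^sub>R y)"
  define G where "G = insert x F"
  define u where "u y = (1 - t) * w y + (if y = x then t else 0)" for y
  have fin: "finite F" "finite G" and xG: "x \<in> G" and FG: "F \<subseteq> G"
    and w0: "\<And>y. y \<notin> F \<Longrightarrow> w y = 0" and w1: "sum w F = 1"
    using p by (auto simp: prob_weight_def G_def)
  have wG: "(\<Sum>y\<in>G. w y * g y) = (\<Sum>y\<in>F. w y * g y)" for g
    using fin FG w0 by (intro sum.mono_neutral_right) auto
  have wG': "(\<Sum>y\<in>G. w y *\<^sub>R y) = m"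
    unfolding m_def using fin FG w0 by (intro sum.mono_neutral_right) auto
  have u1: "(\<Sum>y\<in>G. u y * g y) = (1 - t) * (\<Sum>y\<in>F. w y * g y) + t * g x" for g
  proof -
    have "u y * g y = (1 - t) * (w y * g y) + (if y = x then t * g x else 0)" for y
      by (simp add: u_def distrib_right)
    then show ?thesis
      using fin xG by (simp add: sum.distrib sum_distrib_left[symmetric] wG)
  qed
  have u2: "(\<Sum>y\<in>G. u y *\<^sub>R y) = (1 - t) *\<^sub>R m + t *\<^sub>R x"
  proof -
    have "u y *\<^sub>R y = (1 - t) *\<^sub>R (w y *\<^sub>R y) + (if y = x then t *\<^sub>R x else 0)" for y
      by (simp add: u_def scaleR_add_left)
    then show ?thesis
      using fin xG by (simp del: scaleR_scaleR add: sum.distrib scaleR_sum_right[symmetric] wG')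
  qed
  have su: "sum u G = 1"
    using u1[of "\<lambda>_. 1"] w1 by simp
  have "prob_weight A G u"
    using p fin su t \<open>x \<in> A\<close> by (auto simp: prob_weight_def G_def u_def)
  moreover have "spread G u = (1 - t) * spread F w + t * (1 - t) * (norm (x - m))\<^sup>2"
  proof -
    have "(\<Sum>y\<in>F. w y * (norm (y - m))\<^sup>2) = spread F w"
      using spread_huygens[of w F m] w1 by (simp add: m_def)
    moreover have "(norm (m - ((1 - t) *\<^sub>R m + t *\<^sub>R x)))\<^sup>2 = t\<^sup>2 * (norm (x - m))\<^sup>2"
    proof -
      have "m - ((1 - t) *\<^sub>R m + t *\<^sub>R x) = (- t) *\<^sub>R (x - m)"
        by (simp add: algebra_simps)
      then show ?thesis
        by (metis norm_scaleR power_mult_distrib power2_abs power2_minus)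
    qed
    ultimately show ?thesis
      using spread_huygens[of u G m] unfolding su u1 u2 by (simp add: algebra_simps power2_eq_square)
  qed
  ultimately show ?thesis
    using that by (auto simp: m_def)
qed

text \<open>
  If \<open>w\<close> nearly maximises the spread, then moving a small mass \<open>t\<close> to any \<open>x \<in> A\<close> cannot gain
  much, which bounds the distance from \<open>x\<close> to the barycentre of \<open>w\<close>.
\<close>

lemma exists_spread_near_chebyshev_radius:
  fixes A :: "'a::real_inner set"
  assumes bd: "bounded A" and ne: "A \<noteq> {}" and \<delta>: "0 < \<delta>"
  shows "\<exists>F w. prob_weight A F w \<and> spread F w > (chebyshev_radius UNIV A)\<^sup>2 - \<delta>"
proof (rule ccontr)
  assume no: "\<not> ?thesis"
  define r where "r = chebyshev_radius UNIV A"
  define P where "P = {spread F w | F w. prob_weight A F w}"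
  have le: "spread F w \<le> r\<^sup>2 - \<delta>" if "prob_weight A F w" for F w
    using no that by (force simp: r_def not_less)
  obtain a where a: "a \<in> A" using ne by auto
  have "prob_weight A {a} (\<lambda>x. if x = a then 1 else 0)"
    using a by (auto simp: prob_weight_def)
  then have Pne: "P \<noteq> {}" by (auto simp: P_def)
  have bdP: "bdd_above P" using le by (auto simp: P_def bdd_above_def)
  define S where "S = Sup P"
  have S_le: "S \<le> r\<^sup>2 - \<delta>"
    unfolding S_def using Pne le by (intro cSup_least) (auto simp: P_def)
  have r0: "0 \<le> r" unfolding r_def by (rule chebyshev_radius_nonneg[OF bd ne])
  \<comment> \<open>As \<open>t\<close> tends to 0 this would give \<open>r\<^sup>2 \<le> S\<close>,
    against \<open>S_le\<close>.\<close>
  have key: "r\<^sup>2 * (1 - t) \<le> t + S" if t: "0 < t" "t < 1" for t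
  proof -
    \<comment> \<open>The slack is quadratic in the moved mass \<open>t\<close>, so it is still
      small after the later division by \<open>t\<close>.\<close>
    have "S - t\<^sup>2 < Sup P" using t by (simp add: S_def)
    then obtain F w where p: "prob_weight A F w" and sp: "S - t\<^sup>2 < spread F w"
      using less_cSup_iff[OF Pne bdP] by (auto simp: P_def)
    define m where "m = (\<Sum>y\<in>F. w y *\<^sub>R y)"
    have spS: "spread F w \<le> S"
      unfolding S_def using p bdP by (intro cSup_upper) (auto simp: P_def)
    have S0: "0 \<le> S"
      using spS spread_nonneg[of F w] p by (auto simp: prob_weight_def)
    have "(norm (x - m))\<^sup>2 \<le> (t + S) / (1 - t)" if x: "x \<in> A" for x
    proof -
      obtain G u where "prob_weight A G u" and
        sG: "spread G u = (1 - t) * spread F w + t * (1 - t) * (norm (x - m))\<^sup>2"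
        using prob_weight_move[OF p x, of t] t unfolding m_def by auto
      then have "spread G u \<le> S"
        unfolding S_def using bdP by (intro cSup_upper) (unfold P_def, blast)
      moreover have "(1 - t) * spread F w \<ge> (1 - t) * (S - t\<^sup>2)"
        using sp t by (intro mult_left_mono) auto
      ultimately have "t * (1 - t) * (norm (x - m))\<^sup>2 \<le> S - (1 - t) * (S - t\<^sup>2)"
        using sG by linarith
      also have "\<dots> \<le> t * (S + t)"
        using t by (simp add: algebra_simps power2_eq_square)
      finally have "(1 - t) * (norm (x - m))\<^sup>2 \<le> S + t"
        using t by (simp add: mult.assoc)
      then show ?thesis
        using t by (simp add: field_simps)
    qed
    then have "norm (x - m) \<le> sqrt ((t + S) / (1 - t))" if "x \<in> A" for x
      using that real_le_rsqrt by blast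
    then have "r \<le> sqrt ((t + S) / (1 - t))"
      unfolding r_def by (rule chebyshev_radius_le[OF bd ne])
    then have "r\<^sup>2 \<le> (t + S) / (1 - t)"
      using r0 S0 t by (metis abs_of_nonneg sqrt_ge_absD)
    then show ?thesis
      using t by (simp add: field_simps)
  qed
  \<comment> \<open>By \<open>key\<close> and \<open>S_le\<close>,
    \<open>\<delta> \<le> t * (1 + r\<^sup>2)\<close>; this choice makes the right side at most
    \<open>\<delta> / 2\<close>, and the cap \<open>1/2\<close> keeps \<open>t\<close> below
    1.\<close>
  define t where "t = min (1/2) (\<delta> / (2 * (1 + r\<^sup>2)))"
  have r1: "0 < 1 + r\<^sup>2" by (smt (verit) zero_le_power2)
  have t: "0 < t" "t < 1" using \<delta> r1 by (auto simp: t_def)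
  have "t * (1 + r\<^sup>2) \<le> \<delta> / (2 * (1 + r\<^sup>2)) * (1 + r\<^sup>2)"
    using r1 by (intro mult_right_mono) (auto simp: t_def)
  also have "\<dots> = \<delta> / 2" using r1 by (simp add: field_simps)
  finally show False
    using key[OF t] S_le \<delta> by (simp add: algebra_simps)
qed

section \<open>The Jung constant in infinite dimension\<close>

text \<open>Jung's inequality: with \<open>d\<close> half the squared diameter,
  \<open>spread_deficit\<close> has only non-negative terms, and the spread comes arbitrarily close
  to the squared radius.\<close>

lemma chebyshev_radius_le_diameter:
  fixes A :: "'a::real_inner set"
  assumes bd: "bounded A" and ne: "A \<noteq> {}"
  shows "(chebyshev_radius UNIV A)\<^sup>2 \<le> (diameter A)\<^sup>2 / 2"
proof (rule field_le_epsilon)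
  fix e :: real assume "0 < e"
  obtain F w where p: "prob_weight A F w" and s: "spread F w > (chebyshev_radius UNIV A)\<^sup>2 - e"
    using exists_spread_near_chebyshev_radius[OF bd ne \<open>0 < e\<close>] by blast
  have "0 \<le> w x * w y * (2 * ((diameter A)\<^sup>2 / 2) - (norm (x - y))\<^sup>2)" if "x \<in> F" "y \<in> F" for x y
  proof -
    have "norm (x - y) \<le> diameter A"
      using that p diameter_bounded_bound[OF bd, of x y] by (auto simp: prob_weight_def dist_norm)
    then show ?thesis
      using p by (auto simp: prob_weight_def power_mono)
  qed
  then have "0 \<le> (sum w F)\<^sup>2 * ((diameter A)\<^sup>2 / 2) - spread F w"
    unfolding spread_deficit by (simp add: sum_nonneg)
  then show "(chebyshev_radius UNIV A)\<^sup>2 \<le> (diameter A)\<^sup>2 / 2 + e"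
    using s p by (simp add: prob_weight_def)
qed

text \<open>The constant weight 1 on \<open>V\<close> has mass \<open>n\<close>, and its
  \<open>n * (n - 1)\<close> ordered pairs of distinct points each contribute at least
  \<open>l\<^sup>2 / 2\<close> to the spread.\<close>

lemma separated_le_chebyshev_radius:
  fixes A :: "'a::real_inner set"
  assumes bd: "bounded A" and VA: "V \<subseteq> A" and card: "card V = n" "0 < n"
    and sep: "\<And>x y. x \<in> V \<Longrightarrow> y \<in> V \<Longrightarrow> x \<noteq> y \<Longrightarrow> l \<le> norm (x - y)" and l: "0 \<le> l"
  shows "(1 - 1 / n) * l\<^sup>2 / 2 \<le> (chebyshev_radius UNIV A)\<^sup>2"
proof -
  have fin: "finite V" using card card_ge_0_finite by metis
  have "(\<Sum>y\<in>V. (norm (x - y))\<^sup>2) \<ge> (real n - 1) * l\<^sup>2" if x: "x \<in> V" for x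
  proof -
    have "(\<Sum>y\<in>V. (norm (x - y))\<^sup>2) = (\<Sum>y\<in>V - {x}. (norm (x - y))\<^sup>2)"
      using fin x by (subst sum.remove[of _ x]) auto
    also have "\<dots> \<ge> (\<Sum>y\<in>V - {x}. l\<^sup>2)"
      using sep x l by (intro sum_mono power_mono) auto
    finally show ?thesis
      using card x fin by (simp add: of_nat_diff)
  qed
  then have "(\<Sum>x\<in>V. \<Sum>y\<in>V. (norm (x - y))\<^sup>2) \<ge> (\<Sum>x\<in>V. (real n - 1) * l\<^sup>2)"
    by (rule sum_mono)
  then have "real n * ((real n - 1) * l\<^sup>2) / 2 \<le> spread V (\<lambda>_. 1)"
    using card by (simp add: spread_def)
  also have "\<dots> \<le> (real n * chebyshev_radius UNIV A)\<^sup>2"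
    using spread_le_chebyshev_radius[OF bd VA, of "\<lambda>_. 1"] card by simp
  also have "real n * ((real n - 1) * l\<^sup>2) / 2 = (real n)\<^sup>2 * ((1 - 1 / n) * l\<^sup>2 / 2)"
    using card(2) by (simp add: field_simps power2_eq_square)
  finally show ?thesis
    using card(2) by (simp add: power_mult_distrib)
qed

text \<open>Gram-Schmidt: a finite set never spans, so a vector outside its span leaves a non-zero
  orthogonal remainder.\<close>

lemma exists_orthonormal_of_card:
  fixes n :: nat
  assumes "\<nexists>B :: 'h::real_inner set. finite B \<and> span B = UNIV"
  shows "\<exists>B :: 'h set. finite B \<and> card B = n \<and> (\<forall>x\<in>B. norm x = 1) \<and>
    (\<forall>x\<in>B. \<forall>y\<in>B. x \<noteq> y \<longrightarrow> inner x y = 0)"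
proof (induction n)
  case 0
  show ?case by (intro exI[of _ "{}"]) auto
next
  case (Suc n)
  then obtain B :: "'h set" where "finite B \<and> card B = n \<and> (\<forall>x\<in>B. norm x = 1) \<and>
    (\<forall>x\<in>B. \<forall>y\<in>B. x \<noteq> y \<longrightarrow> inner x y = 0)" ..
  then have B: "finite B" "card B = n" "\<And>x. x \<in> B \<Longrightarrow> norm x = 1"
    "\<And>x y. x \<in> B \<Longrightarrow> y \<in> B \<Longrightarrow> x \<noteq> y \<Longrightarrow> inner x y = 0"
    by simp_all
  obtain x where x: "x \<notin> span B"
    using assms B(1) by blast
  define y where "y = x - (\<Sum>b\<in>B. inner x b *\<^sub>R b)"
  have "(\<Sum>b\<in>B. inner x b *\<^sub>R b) \<in> span B"
    by (intro span_sum span_scale span_base)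
  then have y0: "y \<noteq> 0" using x by (auto simp: y_def)
  have orth: "inner y b = 0" if b: "b \<in> B" for b
  proof -
    have "(\<Sum>c\<in>B. inner x c * inner c b) = (\<Sum>c\<in>B. if c = b then inner x b else 0)"
    proof (rule sum.cong[OF refl])
      fix c assume c: "c \<in> B"
      show "inner x c * inner c b = (if c = b then inner x b else 0)"
        using B(3)[OF b] B(4)[OF c b] by (simp add: dot_square_norm)
    qed
    then show ?thesis
      using B(1) b by (simp add: y_def inner_diff_left inner_sum_left)
  qed
  define u where "u = y /\<^sub>R norm y"
  have u: "norm u = 1" "\<And>b. b \<in> B \<Longrightarrow> inner u b = 0" "\<And>b. b \<in> B \<Longrightarrow> inner b u = 0"
    using y0 orth by (auto simp: u_def inner_commute)
  have "u \<notin> B"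
    using u(1) u(2)[of u] by (simp add: dot_square_norm) blast
  with B u show ?case
    by (intro exI[of _ "insert u B"]) simp
qed

lemma jung_constant_infinite_dim:
  assumes inf: "\<nexists>B :: 'h::real_inner set. finite B \<and> span B = UNIV"
  shows "jung_constant TYPE('h) = 1 / sqrt 2"
proof -
  define R where "R = {chebyshev_radius UNIV A | A :: 'h set. bounded A \<and> diameter A = 1}"
  have upper: "r \<le> 1 / sqrt 2" if r: "r \<in> R" for r
  proof -
    obtain A :: "'h set" where A: "bounded A" "diameter A = 1" "r = chebyshev_radius UNIV A"
      using r unfolding R_def by blast
    have "A \<noteq> {}" using A(2) by auto
    then have "r\<^sup>2 \<le> 1 / 2"
      using chebyshev_radius_le_diameter[OF A(1)] A(2,3) by simp
    then have "r \<le> sqrt (1 / 2)"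
      by (rule real_le_rsqrt)
    then show ?thesis
      by (simp add: real_sqrt_divide)
  qed
  \<comment> \<open>At least two points are taken, so that the diameter below is attained by a
    pair.\<close>
  have lower: "\<exists>r\<in>R. (1 - 1 / real (Suc (Suc n))) / 2 \<le> r\<^sup>2 \<and> 0 \<le> r" for n
  proof -
    obtain B :: "'h set" where "finite B \<and> card B = Suc (Suc n) \<and> (\<forall>x\<in>B. norm x = 1) \<and>
      (\<forall>x\<in>B. \<forall>y\<in>B. x \<noteq> y \<longrightarrow> inner x y = 0)"
      using exists_orthonormal_of_card[OF inf] ..
    then have B: "finite B" "card B = Suc (Suc n)" "\<And>x. x \<in> B \<Longrightarrow> norm x = 1"
      "\<And>x y. x \<in> B \<Longrightarrow> y \<in> B \<Longrightarrow> x \<noteq> y \<Longrightarrow> inner x y = 0"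
      by simp_all
    \<comment> \<open>Distinct orthonormal vectors are \<open>sqrt 2\<close> apart, so the scaled
      ones form a regular simplex of edge 1.\<close>
    define A where "A = (\<lambda>x. x /\<^sub>R sqrt 2) ` B"
    have cA: "card A = Suc (Suc n)" and fA: "finite A"
      unfolding A_def using B by (auto simp: card_image inj_on_def)
    have dist: "norm (x - y) = 1" if xy: "x \<in> A" "y \<in> A" "x \<noteq> y" for x y
    proof -
      obtain a b where ab: "a \<in> B" "b \<in> B" "a \<noteq> b" "x = a /\<^sub>R sqrt 2" "y = b /\<^sub>R sqrt 2"
        using xy unfolding A_def by blast
      have "(norm (a - b))\<^sup>2 = (norm a)\<^sup>2 + (norm b)\<^sup>2 - 2 * inner a b"
        by (simp add: power2_norm_eq_inner inner_diff_left inner_diff_right inner_commute)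
      then have "(norm (a - b))\<^sup>2 = 2"
        using B(3)[OF ab(1)] B(3)[OF ab(2)] B(4)[OF ab(1-3)] by simp
      then have "norm (a - b) = sqrt 2"
        by (metis norm_ge_zero real_sqrt_unique)
      then show ?thesis
        using ab by (simp add: scaleR_diff_right[symmetric])
    qed
    obtain x y where xy: "x \<in> A" "y \<in> A" "x \<noteq> y"
      using cA fA by (metis card_le_Suc0_iff_eq not_less_eq_eq Suc_le_mono le0)
    have bA: "bounded A" using fA finite_imp_bounded by blast
    have "diameter A \<le> 1"
    proof (rule diameter_le)
      show "A \<noteq> {} \<or> (0::real) \<le> 1" by simp
      show "norm (x - y) \<le> 1" if "x \<in> A" "y \<in> A" for x y
        using dist[OF that] by (cases "x = y") auto
    qed
    moreover have "1 \<le> diameter A"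
      using diameter_bounded_bound[OF bA xy(1,2)] dist[OF xy] by (simp add: dist_norm)
    ultimately have "chebyshev_radius UNIV A \<in> R"
      using bA by (force simp: R_def)
    moreover have "(1 - 1 / real (Suc (Suc n))) / 2 \<le> (chebyshev_radius UNIV A)\<^sup>2"
      using separated_le_chebyshev_radius[OF bA subset_refl cA, of 1] dist by simp
    ultimately show ?thesis
      using chebyshev_radius_nonneg[OF bA] xy by blast
  qed
  have bdd: "bdd_above R" using upper by (auto simp: bdd_above_def)
  have ne: "R \<noteq> {}" using lower[of 0] by auto
  have le: "Sup R \<le> 1 / sqrt 2" using ne upper by (intro cSup_least) auto
  \<comment> \<open>The radius supplied by \<open>lower\<close> varies with \<open>n\<close>;
    replacing it by the fixed \<open>Sup R\<close> permits passing to the limit.\<close>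
  have "(1 - 1 / real (Suc (Suc n))) / 2 \<le> (Sup R)\<^sup>2" for n
    using lower[of n] cSup_upper[OF _ bdd] by (smt (verit, best) power_mono)
  moreover have "(\<lambda>n. (1 - 1 / real (Suc (Suc n))) / 2) \<longlonglongrightarrow> (1 - 0) / 2"
    by (intro tendsto_divide[OF _ tendsto_const] tendsto_diff tendsto_const
        LIMSEQ_Suc[OF LIMSEQ_Suc[OF lim_1_over_n]]) simp
  ultimately have "1 / 2 \<le> (Sup R)\<^sup>2"
    by (intro LIMSEQ_le_const2[of _ "1/2"]) auto
  moreover have "0 \<le> Sup R"
    using lower[of 0] cSup_upper[OF _ bdd] by (smt (verit, best))
  ultimately have "1 / sqrt 2 \<le> Sup R"
    using real_le_lsqrt[of "Sup R" "1/2"] by (simp add: real_sqrt_divide)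
  then show ?thesis
    using le by (simp add: jung_constant_def R_def)
qed

section \<open>Selecting points and proving affine independence\<close>

text \<open>Greedy choice among points whose \<open>B\<close>-neighbourhood has weight at most
  \<open>1 / k\<close>. They carry weight above \<open>1 - 1 / k\<close>, while fewer than
  \<open>k\<close> chosen points block at most \<open>(k - 1) / k\<close>.\<close>

lemma exists_independent_of_weight:
  fixes w :: "'a \<Rightarrow> real" and B :: "'a \<Rightarrow> 'a \<Rightarrow> bool" and k :: nat
  assumes fin: "finite F" and w0: "\<And>x. x \<in> F \<Longrightarrow> 0 \<le> w x" and w1: "sum w F = 1" and k: "0 < k"
    and refl: "\<And>x. B x x" and sym: "\<And>x y. B x y \<Longrightarrow> B y x"
    and bad: "(\<Sum>x\<in>F. \<Sum>y\<in>F. if B x y then w x * w y else 0) < (1 / k)\<^sup>2"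
  shows "\<exists>V\<subseteq>F. card V = k \<and> (\<forall>x\<in>V. \<forall>y\<in>V. x \<noteq> y \<longrightarrow> \<not> B x y)"
proof -
  define \<tau> where "\<tau> = 1 / real k"
  have \<tau>: "0 < \<tau>" "real k * \<tau> = 1" using k by (auto simp: \<tau>_def)
  define b where "b x = (\<Sum>y\<in>F. if B x y then w y else 0)" for x
  define G where "G = {x \<in> F. b x \<le> \<tau>}"
  have b0: "0 \<le> b x" for x unfolding b_def using w0 by (intro sum_nonneg) auto
  have G: "G \<subseteq> F" "finite G" using fin by (auto simp: G_def)
  \<comment> \<open>Markov's inequality for \<open>b\<close>: points outside \<open>G\<close> have
    \<open>b x > \<tau>\<close>, so their weight is less than \<open>\<tau>\<close>.\<close>
  have "\<tau> * sum w (F - G) = (\<Sum>x\<in>F - G. w x * \<tau>)"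
    by (simp add: sum_distrib_left mult.commute)
  also have "\<dots> \<le> (\<Sum>x\<in>F - G. w x * b x)"
    using w0 by (intro sum_mono mult_left_mono) (auto simp: G_def)
  also have "\<dots> \<le> (\<Sum>x\<in>F. w x * b x)"
    using w0 b0 fin by (intro sum_mono2) auto
  also have "\<dots> = (\<Sum>x\<in>F. \<Sum>y\<in>F. if B x y then w x * w y else 0)"
    by (simp add: b_def sum_distrib_left if_distrib[of "\<lambda>z. _ * z"] cong: if_cong)
  also have "\<dots> < \<tau> * \<tau>"
    using bad by (simp add: \<tau>_def power2_eq_square)
  finally have "sum w (F - G) < \<tau>"
    using \<tau> by simp
  then have wG: "1 - \<tau> < sum w G"
    using w1 sum.subset_diff[OF G(1) fin, of w] by linarith
  have "j \<le> k \<Longrightarrow> \<exists>V\<subseteq>G. card V = j \<and> (\<forall>x\<in>V. \<forall>y\<in>V. x \<noteq> y \<longrightarrow> \<not> B x y)" for j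
  proof (induction j)
    case 0
    show ?case by (intro exI[of _ "{}"]) auto
  next
    case (Suc j)
    then obtain V where V: "V \<subseteq> G" "card V = j" "\<And>x y. x \<in> V \<Longrightarrow> y \<in> V \<Longrightarrow> x \<noteq> y \<Longrightarrow> \<not> B x y"
      by auto
    have fV: "finite V" using V(1) G(2) finite_subset by blast
    have "\<exists>x\<in>G. \<forall>v\<in>V. \<not> B v x"
    proof (rule ccontr)
      assume "\<not> ?thesis"
      then have cov: "\<exists>v\<in>V. B v x" if "x \<in> G" for x using that by blast
      have "w x \<le> (\<Sum>v\<in>V. if B v x then w x else 0)" if x: "x \<in> G" for x
      proof -
        obtain v where v: "v \<in> V" "B v x" using cov[OF x] by blast
        have "(if B v x then w x else 0) \<le> (\<Sum>v\<in>V. if B v x then w x else 0)"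
          using v fV x G w0 by (intro member_le_sum) auto
        then show ?thesis using v by simp
      qed
      then have "sum w G \<le> (\<Sum>x\<in>G. \<Sum>v\<in>V. if B v x then w x else 0)"
        by (rule sum_mono)
      also have "\<dots> \<le> (\<Sum>x\<in>F. \<Sum>v\<in>V. if B v x then w x else 0)"
        using fin G w0 by (intro sum_mono2 sum_nonneg) auto
      also have "\<dots> = (\<Sum>v\<in>V. b v)"
        unfolding b_def by (rule sum.swap)
      also have "\<dots> \<le> (\<Sum>v\<in>V. \<tau>)"
        using V(1) by (intro sum_mono) (auto simp: G_def)
      also have "\<dots> = real j * \<tau>" using V(2) by simp
      \<comment> \<open>If all of \<open>G\<close> were blocked,
        \<open>1 - \<tau> < sum w G \<le> j * \<tau>\<close>, which is impossible for
        \<open>j < k\<close>.\<close>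
      finally have "1 < real (Suc j) * \<tau>" using wG by (simp add: algebra_simps)
      moreover have "real (Suc j) * \<tau> \<le> real k * \<tau>"
        using Suc.prems \<tau> by (intro mult_right_mono) auto
      ultimately show False using \<tau> by simp
    qed
    then obtain x where x: "x \<in> G" "\<And>v. v \<in> V \<Longrightarrow> \<not> B v x" by blast
    \<comment> \<open>Reflexivity of \<open>B\<close> makes the new point distinct from those
      already chosen.\<close>
    then have "x \<notin> V" "\<And>v. v \<in> V \<Longrightarrow> \<not> B x v" using refl sym by blast+
    then show ?case
      using V x fV by (intro exI[of _ "insert x V"]) auto
  qed
  from this[of k] show ?thesis using G(1) by blast
qed

text \<open>An affine dependency is a signed weight with mass 0 and weighted sum 0, hence spread 0
  by Huygens' identity. For nearly regular \<open>V\<close> the corresponding quadratic form is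
  positive definite, its diagonal dominating.\<close>

lemma affine_independent_of_nearly_regular:
  fixes V :: "'a::real_inner set" and e :: real
  assumes fin: "finite V" and e: "e * card V < 2"
    and near: "\<And>x y. x \<in> V \<Longrightarrow> y \<in> V \<Longrightarrow> x \<noteq> y \<Longrightarrow> \<bar>2 - (norm (x - y))\<^sup>2\<bar> \<le> e"
    and e0: "0 \<le> e"
  shows "\<not> affine_dependent V"
proof
  assume "affine_dependent V"
  then obtain c where c: "sum c V = 0" "\<exists>v\<in>V. c v \<noteq> 0" "(\<Sum>v\<in>V. c v *\<^sub>R v) = 0"
    unfolding affine_dependent_explicit_finite[OF fin] by blast
  have "spread V c = 0"
    using spread_huygens[of c V 0] c by simp
  \<comment> \<open>Mass 0 leaves \<open>d\<close> free; \<open>d = 1\<close> gives diagonal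
    coefficients 2 and off-diagonal ones of modulus at most \<open>e\<close>.\<close>
  then have "(\<Sum>x\<in>V. \<Sum>y\<in>V. c x * c y * (2 * 1 - (norm (x - y))\<^sup>2)) = 0"
    using spread_deficit[of c V 1] c by simp
  \<comment> \<open>The error term is subtracted on the diagonal too, so that its double sum factors
    as a square, ready for Cauchy-Schwarz.\<close>
  moreover have "(if x = y then 2 * (c x)\<^sup>2 else 0) - e * (\<bar>c x\<bar> * \<bar>c y\<bar>)
      \<le> c x * c y * (2 * 1 - (norm (x - y))\<^sup>2)" if "x \<in> V" "y \<in> V" for x y
  proof (cases "x = y")
    case True
    then show ?thesis using e0 by (simp add: power2_eq_square)
  next
    case False
    have "\<bar>c x * c y * (2 - (norm (x - y))\<^sup>2)\<bar> \<le> \<bar>c x * c y\<bar> * e"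
      unfolding abs_mult[of "c x * c y"] using near[OF that False] by (intro mult_left_mono) auto
    then show ?thesis using False by (simp add: abs_mult algebra_simps)
  qed
  then have "(\<Sum>x\<in>V. \<Sum>y\<in>V. (if x = y then 2 * (c x)\<^sup>2 else 0) - e * (\<bar>c x\<bar> * \<bar>c y\<bar>))
      \<le> (\<Sum>x\<in>V. \<Sum>y\<in>V. c x * c y * (2 * 1 - (norm (x - y))\<^sup>2))"
    by (intro sum_mono)
  moreover have "(\<Sum>x\<in>V. \<Sum>y\<in>V. (if x = y then 2 * (c x)\<^sup>2 else 0) - e * (\<bar>c x\<bar> * \<bar>c y\<bar>))
      = 2 * (\<Sum>x\<in>V. (c x)\<^sup>2) - e * (\<Sum>x\<in>V. \<bar>c x\<bar>)\<^sup>2"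
    using fin by (simp add: sum_subtractf sum_distrib_left[symmetric] power2_eq_square sum_product)
  moreover have "e * (\<Sum>x\<in>V. \<bar>c x\<bar>)\<^sup>2 \<le> e * (card V * (\<Sum>x\<in>V. (c x)\<^sup>2))"
    using sum_squared_le_sum_of_squares[of "\<lambda>x. \<bar>c x\<bar>" V] e0
    by (intro mult_left_mono) (auto simp: mult.commute)
  ultimately have "2 * (\<Sum>x\<in>V. (c x)\<^sup>2) \<le> (e * card V) * (\<Sum>x\<in>V. (c x)\<^sup>2)"
    by (simp add: mult.assoc)
  moreover have "0 < (\<Sum>x\<in>V. (c x)\<^sup>2)"
    using c(2) fin by (auto intro!: sum_pos2)
  ultimately show False using e by auto
qed

section \<open>The measure of non-compactness\<close>

text \<open>One ball about a nearly optimal centre is a finite cover; the slack \<open>e\<close>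
  allows for an infimum that is not attained.\<close>

lemma hausdorff_mnc_le_chebyshev_radius:
  fixes A :: "'a::real_normed_vector set"
  assumes "bounded A" and "A \<noteq> {}"
  shows "hausdorff_mnc A \<le> chebyshev_radius UNIV A"
proof (rule field_le_epsilon)
  fix e :: real assume e: "0 < e"
  have "(INF y\<in>UNIV. SUP x\<in>A. norm (x - y)) < chebyshev_radius UNIV A + e"
    using e by (simp add: chebyshev_radius_def)
  then obtain y where y: "(SUP x\<in>A. norm (x - y)) < chebyshev_radius UNIV A + e"
    using Sup_norm_nonneg[OF assms] by (subst (asm) cINF_less_iff) (auto simp: bdd_below_def)
  have "A \<subseteq> (\<Union>c\<in>{y}. cball c (chebyshev_radius UNIV A + e))"
    using norm_le_Sup_norm[OF assms(1), of _ y] y by (fastforce simp: dist_norm norm_minus_commute)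
  moreover have "0 < chebyshev_radius UNIV A + e"
    using chebyshev_radius_nonneg[OF assms] e by simp
  ultimately show "hausdorff_mnc A \<le> chebyshev_radius UNIV A + e"
    unfolding hausdorff_mnc_def
    by (intro cInf_lower) (auto simp: bdd_below_def intro: exI[of _ "{y}"] exI[of _ 0])
qed

text \<open>Some ball of the cover carries at least the average share of a nearly maximising weight.
  Restricting to it does not increase the deficit, so \<open>spread_le_ball\<close> forces a large
  radius.\<close>

lemma finite_cover_radius_ge:
  fixes A :: "'a::real_inner set"
  assumes bd: "bounded A" and ne: "A \<noteq> {}" and d: "(chebyshev_radius UNIV A)\<^sup>2 = (diameter A)\<^sup>2 / 2"
    and r: "0 < r" and C: "finite C" "A \<subseteq> (\<Union>c\<in>C. cball c r)"
  shows "chebyshev_radius UNIV A \<le> r"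
proof -
  define \<rho> where "\<rho> = chebyshev_radius UNIV A"
  define N where "N = real (card C)"
  have "C \<noteq> {}" using C ne by auto
  then have N: "0 < N" using C by (simp add: N_def card_gt_0_iff)
  have "\<rho>\<^sup>2 \<le> r\<^sup>2 + e" if e: "0 < e" for e
  proof -
    \<comment> \<open>The restricted mass \<open>W\<close> is at least \<open>1 / N\<close>, so this
      tolerance becomes at most \<open>e\<close> after division by \<open>W\<^sup>2\<close>.\<close>
    have "0 < e / N\<^sup>2" using e N by simp
    then obtain F w where p: "prob_weight A F w" and s: "spread F w > \<rho>\<^sup>2 - e / N\<^sup>2"
      using exists_spread_near_chebyshev_radius[OF bd ne] unfolding \<rho>_def by blast
    have fF: "finite F" and FA: "F \<subseteq> A" and w0: "\<And>x. 0 \<le> w x" and w1: "sum w F = 1"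
      using p by (auto simp: prob_weight_def)
    define I where "I c = F \<inter> cball c r" for c
    have "\<exists>c\<in>C. 1 / N \<le> sum w (I c)"
    proof (rule ccontr)
      assume "\<not> ?thesis"
      then have "(\<Sum>c\<in>C. sum w (I c)) < (\<Sum>c\<in>C. 1 / N)"
        using C \<open>C \<noteq> {}\<close> by (intro sum_strict_mono) (auto simp: not_le)
      moreover have "(\<Sum>c\<in>C. 1 / N) = 1" using N by (simp add: N_def)
      \<comment> \<open>Only an inequality, since the balls may overlap.\<close>
      moreover have "sum w F \<le> (\<Sum>c\<in>C. sum w (I c))"
      proof -
        have "w x \<le> (\<Sum>c\<in>C. if x \<in> cball c r then w x else 0)" if x: "x \<in> F" for x
        proof -
          obtain c where c: "c \<in> C" "x \<in> cball c r" using C FA x by blast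
          have "(if x \<in> cball c r then w x else 0) \<le> (\<Sum>c\<in>C. if x \<in> cball c r then w x else 0)"
            using c C w0 by (intro member_le_sum) auto
          then show ?thesis using c by simp
        qed
        then have "sum w F \<le> (\<Sum>x\<in>F. \<Sum>c\<in>C. if x \<in> cball c r then w x else 0)"
          by (rule sum_mono)
        also have "\<dots> = (\<Sum>c\<in>C. \<Sum>x\<in>F. if x \<in> cball c r then w x else 0)"
          by (rule sum.swap)
        also have "\<dots> = (\<Sum>c\<in>C. sum w (I c))"
          unfolding I_def using fF by (simp only: sum.inter_restrict)
        finally show ?thesis .
      qed
      ultimately show False using w1 by simp
    qed
    then obtain c where c: "c \<in> C" "1 / N \<le> sum w (I c)" by blast
    define W where "W = sum w (I c)"
    have W: "1 / N \<le> W" "0 < W" using c N by (auto simp: W_def intro: less_le_trans[of 0 "1/N"])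
    have IF: "I c \<subseteq> F" by (auto simp: I_def)
    have nn: "0 \<le> w x * w y * (2 * \<rho>\<^sup>2 - (norm (x - y))\<^sup>2)" if "x \<in> F" "y \<in> F" for x y
    proof -
      have "norm (x - y) \<le> diameter A"
        using that FA diameter_bounded_bound[OF bd, of x y] by (auto simp: dist_norm)
      then have "(norm (x - y))\<^sup>2 \<le> (diameter A)\<^sup>2" by (intro power_mono) auto
      then have "(norm (x - y))\<^sup>2 \<le> 2 * \<rho>\<^sup>2" using d by (simp add: \<rho>_def)
      then show ?thesis using w0 by auto
    qed
    have "W\<^sup>2 * \<rho>\<^sup>2 - spread (I c) w \<le> (sum w F)\<^sup>2 * \<rho>\<^sup>2 - spread F w"
    proof -
      have "(\<Sum>x\<in>I c. \<Sum>y\<in>I c. w x * w y * (2 * \<rho>\<^sup>2 - (norm (x - y))\<^sup>2))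
          \<le> (\<Sum>x\<in>I c. \<Sum>y\<in>F. w x * w y * (2 * \<rho>\<^sup>2 - (norm (x - y))\<^sup>2))"
        using nn IF fF by (intro sum_mono sum_mono2) auto
      also have "\<dots> \<le> (\<Sum>x\<in>F. \<Sum>y\<in>F. w x * w y * (2 * \<rho>\<^sup>2 - (norm (x - y))\<^sup>2))"
        using nn IF fF by (intro sum_mono2) (auto intro!: sum_nonneg)
      finally show ?thesis unfolding W_def spread_deficit by simp
    qed
    moreover have "spread (I c) w \<le> (W * r)\<^sup>2"
      unfolding W_def using w0 by (intro spread_le_ball[of _ _ c]) (auto simp: I_def dist_norm norm_minus_commute)
    ultimately have "W\<^sup>2 * \<rho>\<^sup>2 \<le> W\<^sup>2 * r\<^sup>2 + e / N\<^sup>2"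
      using s w1 by (simp add: power_mult_distrib)
    also have "e / N\<^sup>2 = (1 / N)\<^sup>2 * e" by (simp add: power_divide)
    also have "\<dots> \<le> W\<^sup>2 * e"
      using W N e by (intro mult_right_mono power_mono) auto
    finally have "W\<^sup>2 * \<rho>\<^sup>2 \<le> W\<^sup>2 * (r\<^sup>2 + e)" by (simp add: distrib_left)
    then show ?thesis using W by simp
  qed
  then have "\<rho>\<^sup>2 \<le> r\<^sup>2" by (rule field_le_epsilon)
  then have "\<rho> \<le> r" using r by (rule power2_le_imp_le[OF _ less_imp_le])
  then show ?thesis by (simp add: \<rho>_def)
qed

section \<open>Nearly regular simplices in an extremal set\<close>

text \<open>Every pair closer than \<open>l\<close> costs at least \<open>\<eta>\<close> in the
  deficit, so near-maximal spread makes such pairs rare enough for the greedy choice.\<close>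

lemma exists_nearly_regular_simplex:
  fixes A :: "'a::real_inner set"
  assumes bd: "bounded A" and r1: "chebyshev_radius UNIV A = 1" and d: "diameter A = sqrt 2"
    and \<epsilon>: "0 < \<epsilon>"
  shows "\<exists>V. card V = p + 1 \<and> \<not> affine_dependent V \<and> V \<subseteq> A \<and>
     (\<forall>x\<in>V. \<forall>y\<in>V. x \<noteq> y \<longrightarrow> sqrt 2 - \<epsilon> \<le> norm (x - y))"
proof -
  have ne: "A \<noteq> {}" using d by auto
  \<comment> \<open>This \<open>e\<close> serves twice: \<open>e\<^sup>2\<close> is the threshold of
    the greedy choice, and \<open>e\<close> times the number of vertices is 1, below the bound 2 for
    affine independence.\<close>
  define e where "e = 1 / real (p + 1)"
  have e: "0 < e" "e \<le> 1" "e * real (p + 1) = 1" by (auto simp: e_def)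
  \<comment> \<open>The first bound yields the edge lengths, the second the near-regularity behind
    affine independence.\<close>
  define l where "l = max (sqrt 2 - \<epsilon>) (sqrt (2 - e))"
  have l: "sqrt 2 - \<epsilon> \<le> l" "0 \<le> l" "l < sqrt 2" "2 - e \<le> l\<^sup>2"
  proof -
    show "sqrt 2 - \<epsilon> \<le> l" by (simp add: l_def)
    have "sqrt (2 - e) \<le> l" by (simp add: l_def)
    then show "0 \<le> l" "2 - e \<le> l\<^sup>2"
      using e real_sqrt_ge_zero[of "2 - e"] by (linarith, metis sqrt_le_D)
    show "l < sqrt 2" using e \<epsilon> by (simp add: l_def)
  qed
  define \<eta> where "\<eta> = 2 - l\<^sup>2"
  have "l\<^sup>2 < (sqrt 2)\<^sup>2" using l by (intro power_strict_mono) auto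
  then have \<eta>: "0 < \<eta>" by (simp add: \<eta>_def)
  have "0 < \<eta> * e\<^sup>2 / 2" using \<eta> e by simp
  then obtain F w where p: "prob_weight A F w" and s: "spread F w > 1 - \<eta> * e\<^sup>2 / 2"
    using exists_spread_near_chebyshev_radius[OF bd ne] r1 by (metis one_power2)
  have fF: "finite F" and FA: "F \<subseteq> A" and w0: "\<And>x. 0 \<le> w x" and w1: "sum w F = 1"
    using p by (auto simp: prob_weight_def)
  have le2: "(norm (x - y))\<^sup>2 \<le> 2" if "x \<in> A" "y \<in> A" for x y
    using that diameter_bounded_bound[OF bd, of x y] d
    by (metis dist_norm norm_ge_zero power_mono real_sqrt_pow2 zero_le_numeral)
  define B where "B x y \<longleftrightarrow> norm (x - y) < l" for x y :: 'a
  have "\<eta> * (if B x y then w x * w y else 0) \<le> w x * w y * (2 * 1 - (norm (x - y))\<^sup>2)"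
    if "x \<in> F" "y \<in> F" for x y
  proof (cases "B x y")
    case True
    then have "(norm (x - y))\<^sup>2 \<le> l\<^sup>2" by (intro power_mono) (auto simp: B_def)
    then have "w x * w y * \<eta> \<le> w x * w y * (2 * 1 - (norm (x - y))\<^sup>2)"
      using w0 by (intro mult_left_mono) (auto simp: \<eta>_def)
    then show ?thesis using True by (simp add: mult.commute)
  next
    case False
    have "0 \<le> w x * w y * (2 * 1 - (norm (x - y))\<^sup>2)"
      using w0 le2[of x y] that FA by (intro mult_nonneg_nonneg) auto
    then show ?thesis using False by simp
  qed
  then have "(\<Sum>x\<in>F. \<Sum>y\<in>F. \<eta> * (if B x y then w x * w y else 0))
      \<le> (\<Sum>x\<in>F. \<Sum>y\<in>F. w x * w y * (2 * 1 - (norm (x - y))\<^sup>2))"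
    by (intro sum_mono)
  also have "\<dots> = 2 * (1 - spread F w)"
    using spread_deficit[of w F 1] w1 by simp
  also have "\<dots> < \<eta> * e\<^sup>2" using s by simp
  finally have "\<eta> * (\<Sum>x\<in>F. \<Sum>y\<in>F. if B x y then w x * w y else 0) < \<eta> * e\<^sup>2"
    by (simp add: sum_distrib_left)
  then have "(\<Sum>x\<in>F. \<Sum>y\<in>F. if B x y then w x * w y else 0) < (1 / real (p + 1))\<^sup>2"
    using \<eta> by (simp add: e_def)
  moreover have "B x x" for x
  proof -
    have "0 < l\<^sup>2" using l(4) e by linarith
    then show ?thesis using l(2) by (auto simp: B_def)
  qed
  ultimately obtain V where V: "V \<subseteq> F" "card V = p + 1"
    "\<And>x y. x \<in> V \<Longrightarrow> y \<in> V \<Longrightarrow> x \<noteq> y \<Longrightarrow> \<not> B x y"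
    using exists_independent_of_weight[OF fF w0 w1, of "p + 1" B]
    by (auto simp: B_def norm_minus_commute)
  have far: "l \<le> norm (x - y)" if "x \<in> V" "y \<in> V" "x \<noteq> y" for x y
    using V(3)[OF that] by (simp add: B_def)
  have "\<bar>2 - (norm (x - y))\<^sup>2\<bar> \<le> e" if xy: "x \<in> V" "y \<in> V" "x \<noteq> y" for x y
  proof -
    have "l\<^sup>2 \<le> (norm (x - y))\<^sup>2"
      by (rule power_mono[OF far[OF xy] l(2)])
    moreover have "(norm (x - y))\<^sup>2 \<le> 2"
      using xy V(1) FA by (intro le2) auto
    ultimately show ?thesis
      using l(4) by linarith
  qed
  then have "\<not> affine_dependent V"
    using V e finite_subset[OF V(1) fF] by (intro affine_independent_of_nearly_regular[of _ e]) auto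
  then show ?thesis
    using V FA far l(1) by (intro exI[of _ V]) (auto intro: order_trans)
qed

theorem mainTheorem1:
  assumes infinite_dim: "\<nexists>B :: 'h::{real_inner, banach} set. finite B \<and> span B = UNIV"
  shows "(\<forall>A :: 'h set. extremal_set A \<and> diameter A = sqrt 2 \<longrightarrow>
            hausdorff_mnc A = 1 \<and>
            (\<forall>\<epsilon>\<in>{0<..<sqrt 2}. \<forall>p::nat. p \<ge> 1 \<longrightarrow>
               (\<exists>V \<Delta>. simplex_with_vertices p V \<Delta> \<and> V \<subseteq> A \<and>
                  (\<forall>x\<in>V. \<forall>y\<in>V. x \<noteq> y \<longrightarrow> norm (x - y) \<ge> sqrt 2 - \<epsilon>)))) \<and>
         (\<forall>A :: 'h set. A \<noteq> {} \<and> bounded A \<and> diameter A = sqrt 2 \<and>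
            (\<forall>\<epsilon>\<in>{0<..<sqrt 2}. \<forall>p::nat. p \<ge> 1 \<longrightarrow>
               (\<exists>V \<Delta>. simplex_with_vertices p V \<Delta> \<and> V \<subseteq> A \<and>
                  (\<forall>x\<in>V. \<forall>y\<in>V. x \<noteq> y \<longrightarrow> norm (x - y) \<ge> sqrt 2 - \<epsilon>))) \<longrightarrow>
            extremal_set A)"
proof (intro conjI allI impI)
  note jung = jung_constant_infinite_dim[OF infinite_dim]
  fix A :: "'h set"
  {
    assume A: "extremal_set A \<and> diameter A = sqrt 2"
    \<comment> \<open>The radius is the Jung constant \<open>1 / sqrt 2\<close> times the diameter
      \<open>sqrt 2\<close>.\<close>
    then have bd: "bounded A" and ne: "A \<noteq> {}" and d: "diameter A = sqrt 2"
      and r: "chebyshev_radius UNIV A = 1"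
      using jung by (auto simp: extremal_set_def)
    show "hausdorff_mnc A = 1"
    proof (rule antisym)
      show "hausdorff_mnc A \<le> 1"
        using hausdorff_mnc_le_chebyshev_radius[OF bd ne] r by simp
      obtain a where a: "A \<subseteq> cball 0 a" "0 < a"
        using bd by (metis bounded_subset_ballD ball_subset_cball order_trans)
      show "1 \<le> hausdorff_mnc A"
        unfolding hausdorff_mnc_def
      proof (rule cInf_greatest)
        \<comment> \<open>The infimum needs a non-empty set of radii; one ball about the origin
          provides a member.\<close>
        show "{r. 0 < r \<and> (\<exists>C. finite C \<and> A \<subseteq> (\<Union>c\<in>C. cball c r))} \<noteq> {}"
          using a by (auto intro!: exI[of _ a] exI[of _ "{0}"])
      next
        fix s assume "s \<in> {r. 0 < r \<and> (\<exists>C. finite C \<and> A \<subseteq> (\<Union>c\<in>C. cball c r))}"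
        then show "1 \<le> s"
          using finite_cover_radius_ge[OF bd ne, of s] r d by auto
      qed
    qed
    show "\<forall>\<epsilon>\<in>{0<..<sqrt 2}. \<forall>p::nat. p \<ge> 1 \<longrightarrow>
        (\<exists>V \<Delta>. simplex_with_vertices p V \<Delta> \<and> V \<subseteq> A \<and>
          (\<forall>x\<in>V. \<forall>y\<in>V. x \<noteq> y \<longrightarrow> norm (x - y) \<ge> sqrt 2 - \<epsilon>))"
      using exists_nearly_regular_simplex[OF bd r d]
      unfolding simplex_with_vertices_def by (metis greaterThanLessThan_iff)
  }
  {
    assume A: "A \<noteq> {} \<and> bounded A \<and> diameter A = sqrt 2 \<and>
      (\<forall>\<epsilon>\<in>{0<..<sqrt 2}. \<forall>p::nat. p \<ge> 1 \<longrightarrow>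
         (\<exists>V \<Delta>. simplex_with_vertices p V \<Delta> \<and> V \<subseteq> A \<and>
            (\<forall>x\<in>V. \<forall>y\<in>V. x \<noteq> y \<longrightarrow> norm (x - y) \<ge> sqrt 2 - \<epsilon>)))"
    then have ne: "A \<noteq> {}" and bd: "bounded A" and d: "diameter A = sqrt 2"
      by auto
    have V: "\<exists>V\<subseteq>A. card V = p + 1 \<and> (\<forall>x\<in>V. \<forall>y\<in>V. x \<noteq> y \<longrightarrow> sqrt 2 - \<epsilon> \<le> norm (x - y))"
      if "0 < \<epsilon>" "\<epsilon> < sqrt 2" "1 \<le> p" for \<epsilon> p
      using A that unfolding simplex_with_vertices_def by (metis greaterThanLessThan_iff)
    define r where "r = chebyshev_radius UNIV A"
    have r0: "0 \<le> r" unfolding r_def by (rule chebyshev_radius_nonneg[OF bd ne])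
    have "r\<^sup>2 \<le> 1"
      using chebyshev_radius_le_diameter[OF bd ne] d by (simp add: r_def)
    moreover have "1 \<le> r\<^sup>2"
    proof -
      \<comment> \<open>One index drives both limits: \<open>p = Suc n\<close> gives
        \<open>n + 2\<close> vertices, and \<open>\<epsilon> = 1 / Suc n\<close> stays below
        \<open>sqrt 2\<close>.\<close>
      have "(1 - 1 / real (Suc (Suc n))) * (sqrt 2 - 1 / real (Suc n))\<^sup>2 / 2 \<le> r\<^sup>2" for n
      proof -
        have "1 / real (Suc n) \<le> 1" by simp
        also have "1 < sqrt 2" by simp
        finally have small: "1 / real (Suc n) < sqrt 2" .
        obtain V where "V \<subseteq> A" "card V = Suc (Suc n)"
          "\<And>x y. x \<in> V \<Longrightarrow> y \<in> V \<Longrightarrow> x \<noteq> y \<Longrightarrow> sqrt 2 - 1 / real (Suc n) \<le> norm (x - y)"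
          using V[of "1 / real (Suc n)" "Suc n"] small by auto
        then show ?thesis
          unfolding r_def using small by (intro separated_le_chebyshev_radius[OF bd]) auto
      qed
      moreover have "(\<lambda>n. (1 - 1 / real (Suc (Suc n))) * (sqrt 2 - 1 / real (Suc n))\<^sup>2 / 2)
          \<longlonglongrightarrow> (1 - 0) * (sqrt 2 - 0)\<^sup>2 / 2"
        by (intro tendsto_divide[OF _ tendsto_const] tendsto_mult tendsto_diff tendsto_power
            tendsto_const LIMSEQ_Suc[OF LIMSEQ_Suc[OF lim_1_over_n]] LIMSEQ_Suc[OF lim_1_over_n]) simp
      ultimately show ?thesis
        by (intro LIMSEQ_le_const2[of _ 1]) auto
    qed
    ultimately have "r = 1"
      using r0 by (simp add: power2_eq_1_iff antisym)
    moreover have "\<exists>x\<in>A. \<exists>y\<in>A. x \<noteq> y"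
    proof (rule ccontr)
      assume "\<not> ?thesis"
      then obtain a where "A = {a}" using ne by blast
      then show False using d by simp
    qed
    ultimately show "extremal_set A"
      using bd d jung by (simp add: extremal_set_def r_def)
  }
qed

end
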